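(* Let $f(n)=an^{2}+bn+c$ with $a,b,c\in\mathbb{Z}$, $a\neq 0$, and assume $a,b,c$ are not all even. Consider the sequence $(\nu_{2}(f(n)))_{n\geq 0}$. Then: \begin{enumerate} \item If $a$ and $b$ are even and $c$ is odd, then $\nu_{2}(f(n))=0$ for all $n\in\mathbb{N}$. \item If $a$ is even and $b$ is odd, then $(\nu_{2}(f(n)))_{n\geq 0}$ is unbounded. \item If $a$ is odd and $b$ is even, then: \begin{enumerate} \item if $b^{2}-4ac=0$, then $(\nu_{2}(f(n)))_{n\geq 0}$ is unbounded; \item if $b^{2}-4ac=4^{\ell}\Delta$ where $\ell$ is the largest positive integer with $4^{\ell}\mid b^2-4ac$ and $\Delta\equiv 1 \pmod 8$, then $(\nu_{2}(f(n)))_{n\geq 0}$ is unbounded; \item if $b^{2}-4ac=4^{\ell}\Delta$ where $\ell$ is the largest positive integer with $4^{\ell}\mid b^2-4ac$ and $\Delta\equiv m\pmod 8$ with $m\in\{2,3,5,6,7\}$, then $(\nu_{2}(f(n)))_{n\geq 0}$ is bounded and periodic with minimal period length exactly $2^{\ell}$. \end{enumerate} \item If $a$ and $b$ are odd and $c$ is even, then $(\nu_{2}(f(n)))_{n\geq 0}$ is unbounded. \item If $a$, $b$, $c$ are all odd, then $\nu_{2}(f(n))=0$ for all $n\in\mathbb{N}$. \end{enumerate}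
   Context: $\mathbb{N}=\{0,1,2,\ldots\}$. For an integer $x\neq 0$, $\nu_2(x)$ is the exponent of the highest power of $2$ dividing $x$, and $\nu_2(0)=+\infty$. *)

theory Defs
  imports
    "HOL-Computational_Algebra.Primes"
    "HOL-Library.Extended_Nat"
    "HOL-Number_Theory.Cong"
begin

(* The library's multiplicity assigns 0 to the argument 0, whereas nu_2(0) is infinite. *)
definition nu2 :: "int \<Rightarrow> enat" where
  "nu2 x = (if x = 0 then \<infinity> else enat (multiplicity 2 x))"

(* The bound is a natural number, so a sequence attaining \<infinity> is not bounded. *)
definition bounded_seq :: "(nat \<Rightarrow> enat) \<Rightarrow> bool" where
  "bounded_seq s \<longleftrightarrow> (\<exists>M::nat. \<forall>n. s n \<le> enat M)"

definition is_period :: "(nat \<Rightarrow> 'a) \<Rightarrow> nat \<Rightarrow> bool" where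
  "is_period s p \<longleftrightarrow> 0 < p \<and> (\<forall>n. s (n + p) = s n)"

(* Purely periodic, i.e. without a preperiod. *)
definition periodic_seq :: "(nat \<Rightarrow> 'a) \<Rightarrow> bool" where
  "periodic_seq s \<longleftrightarrow> (\<exists>p. is_period s p)"

(* Only meaningful for periodic sequences. *)
definition minimal_period :: "(nat \<Rightarrow> 'a) \<Rightarrow> nat" where
  "minimal_period s = (LEAST p. is_period s p)"

definition largest_pow4_exponent :: "int \<Rightarrow> nat \<Rightarrow> bool" where
  "largest_pow4_exponent D l \<longleftrightarrow>
     0 < l \<and> 4 ^ l dvd D \<and> (\<forall>k>0. 4 ^ k dvd D \<longrightarrow> k \<le> l)"

end

theory Submission
  imports Defs
begin

text \<open>
  If \<open>b\<close> is odd, Hensel lifting applies: \<open>f (n + 2 ^ k) - f n\<close> is an odd multiple of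
  \<open>2 ^ k\<close> for \<open>k \<ge> 1\<close>, so a root modulo 2 lifts to roots modulo all powers of 2.
  If \<open>a\<close> is odd and \<open>b\<close> is even, then \<open>a f(n) = x\<^sup>2 - D\<close> where \<open>x = a n + b / 2\<close> and
  \<open>D = (b\<^sup>2 - 4 a c) / 4 = 4 ^ (l - 1) \<Delta>\<close>, and \<open>x\<close> runs through all residues modulo every power
  of 2. For \<open>\<Delta> = 8 t + 1\<close>, square roots of \<open>\<Delta>\<close> modulo powers of 2 come from the roots of
  \<open>z\<^sup>2 + z - 2 t\<close>. For the remaining \<open>\<Delta>\<close>, removing factors 4 from \<open>x\<^sup>2 - 4 ^ k \<Delta>\<close> shows that
  its valuation depends only on \<open>x\<close> modulo \<open>2 ^ (k + 1)\<close> and exceeds \<open>2 k\<close> on exactly one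
  residue class.
\<close>

section \<open>The 2-adic valuation, with the value \<open>\<infinity>\<close> at 0\<close>

lemma le_nu2_iff: "enat k \<le> nu2 x \<longleftrightarrow> 2 ^ k dvd x"
  by (auto simp: nu2_def power_dvd_iff_le_multiplicity)

lemma nu2_odd: "odd x \<Longrightarrow> nu2 x = 0"
  by (auto simp: nu2_def zero_enat_def not_dvd_imp_multiplicity_0)

lemma nu2_mult: "nu2 (x * y) = nu2 x + nu2 y"
  by (auto simp: nu2_def prime_elem_multiplicity_mult_distrib)

lemma nu2_power2: "nu2 (2 ^ k) = enat k"
  by (simp add: nu2_def)

lemma unbounded_nu2I:
  assumes "\<And>k. \<exists>n. 2 ^ k dvd f n"
  shows "\<not> bounded_seq (\<lambda>n. nu2 (f n))"
proof
  assume "bounded_seq (\<lambda>n. nu2 (f n))"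
  then obtain M where M: "\<And>n. nu2 (f n) \<le> enat M"
    by (auto simp: bounded_seq_def)
  obtain n where "2 ^ Suc M dvd f n" using assms by blast
  then have "enat (Suc M) \<le> nu2 (f n)" by (simp only: le_nu2_iff)
  then have "enat (Suc M) \<le> enat M" using M[of n] by (rule order_trans)
  then show False by simp
qed

section \<open>Solving congruences modulo powers of 2\<close>

lemma quadratic_root_lift:
  fixes a b c :: int
  assumes "odd b" and "even (a * (int m)\<^sup>2 + b * int m + c)"
  shows "\<exists>n. 2 ^ k dvd a * (int n)\<^sup>2 + b * int n + c"
proof (cases k)
  case (Suc j)
  \<comment> \<open>The induction starts at modulus 2, since the shift \<open>2 ^ Suc j\<close> has
    to be even for the correction below to be odd.\<close>
  have "\<exists>n. 2 ^ Suc j dvd a * (int n)\<^sup>2 + b * int n + c"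
  proof (induction j)
    case 0
    then show ?case using assms(2) by auto
  next
    case (Suc j)
    then obtain n where "2 ^ Suc j dvd a * (int n)\<^sup>2 + b * int n + c" by blast
    then obtain q where q: "a * (int n)\<^sup>2 + b * int n + c = 2 ^ Suc j * q" by blast
    show ?case
    proof (cases "even q")
      case True
      then show ?thesis using q by (intro exI[of _ n]) (auto elim!: evenE)
    next
      case False
      \<comment> \<open>This is the quotient belonging to \<open>n + 2 ^ Suc j\<close>. It differs
        from the odd \<open>q\<close> by an odd number, as \<open>b\<close> is odd and the other
        terms are even.\<close>
      define r where "r = q + 2 * a * int n + b + a * 2 ^ Suc j"
      have "even r" using False assms(1) by (simp add: r_def)
      moreover have "a * (int (n + 2 ^ Suc j))\<^sup>2 + b * int (n + 2 ^ Suc j) + c =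
          (a * (int n)\<^sup>2 + b * int n + c) + 2 ^ Suc j * (2 * a * int n + b + a * 2 ^ Suc j)"
        by (simp add: power2_eq_square algebra_simps)
      then have "a * (int (n + 2 ^ Suc j))\<^sup>2 + b * int (n + 2 ^ Suc j) + c = 2 ^ Suc j * r"
        unfolding q r_def by (simp only: algebra_simps)
      ultimately show ?thesis
        by (intro exI[of _ "n + 2 ^ Suc j"]) (auto elim!: evenE)
    qed
  qed
  then show ?thesis using Suc by simp
qed simp

lemma linear_cong_solvable:
  fixes a :: int
  assumes "odd a"
  shows "\<exists>n::nat. [a * int n + h = x] (mod 2 ^ k)"
proof -
  have "coprime a (2 ^ k)" using assms by simp
  then obtain i where i: "[a * i = 1] (mod 2 ^ k)"
    using cong_solve_coprime_int by blast
  \<comment> \<open>Reduction modulo \<open>2 ^ k\<close> makes the solution nonnegative, so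
    \<open>nat\<close> loses nothing.\<close>
  define n where "n = nat (i * (x - h) mod 2 ^ k)"
  have "[int n = i * (x - h)] (mod 2 ^ k)"
    by (simp add: n_def cong_def)
  then have "[a * int n = a * (i * (x - h))] (mod 2 ^ k)"
    by (rule cong_scalar_left)
  also have "[a * (i * (x - h)) = 1 * (x - h)] (mod 2 ^ k)"
    using cong_scalar_right[OF i, of "x - h"] by (simp add: mult.assoc)
  finally have "[a * int n + h = 1 * (x - h) + h] (mod 2 ^ k)"
    by (rule cong_add) simp
  then show ?thesis by auto
qed

lemma sqrt_mod_power2:
  fixes d :: int
  assumes "[d = 1] (mod 8)"
  shows "\<exists>y. 2 ^ k dvd y\<^sup>2 - d"
proof -
  obtain t where t: "d = 1 + 8 * t"
    using assms by (metis cong_iff_lin cong_sym)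
  \<comment> \<open>The polynomial arises from the substitution y = 2 n + 1; its constant term is
    even, so 0 is a root modulo 2 to start from.\<close>
  obtain n where n: "2 ^ k dvd 1 * (int n)\<^sup>2 + 1 * int n + - 2 * t"
    using quadratic_root_lift[of 1 1 0 "- 2 * t" k] by auto
  have "(2 * int n + 1)\<^sup>2 - d = 4 * (1 * (int n)\<^sup>2 + 1 * int n + - 2 * t)"
    by (simp add: t power2_eq_square algebra_simps)
  then show ?thesis using n by (metis dvd_mult)
qed

section \<open>The valuation of \<open>x\<^sup>2 - 4 ^ k * d\<close>\<close>

text \<open>Even squares are 0 modulo 4, while \<open>d\<close> is 2 modulo 4 if it is even. Odd
  squares are 1 modulo 8, and 1 - d is 4 modulo 8 for residue 5 and 2 modulo 4 for residues 3 and
  7.\<close>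

lemma nu2_square_diff:
  fixes d :: int
  assumes "d mod 8 \<in> {2, 3, 5, 6, 7}"
  shows "nu2 (y\<^sup>2 - d) =
    (if even (y - d) then if d mod 8 = 5 then 2 else 1 else 0)"
proof (cases "even (y - d)")
  case True
  define q r where "q = d div 8" and "r = d mod 8"
  have d: "d = 8 * q + r" by (simp add: q_def r_def)
  have r_cases: "r \<in> {2, 3, 5, 6, 7}" using assms by (simp add: r_def)
  have parity: "even r \<longleftrightarrow> even y" using True by (auto simp: d)
  have "\<exists>w. odd w \<and> y\<^sup>2 - d = 2 ^ (if d mod 8 = 5 then 2 else 1) * w"
  proof (cases "even y")
    case True
    then obtain z where z: "y = 2 * z" by blast
    have r: "r = 2 \<or> r = 6" using r_cases parity True by auto
    then have "y\<^sup>2 - d = 2 * (2 * z\<^sup>2 - 4 * q - r div 2)"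
      by (auto simp: z d power2_eq_square)
    moreover have "odd (2 * z\<^sup>2 - 4 * q - r div 2)" using r by auto
    moreover have "d mod 8 \<noteq> 5" using r by (auto simp: r_def[symmetric])
    ultimately show ?thesis by (intro exI[of _ "2 * z\<^sup>2 - 4 * q - r div 2"]) simp
  next
    case False
    then obtain z where z: "y = 2 * z + 1" by (blast elim: oddE)
    \<comment> \<open>A product of consecutive integers is even; this is why odd squares are 1
      modulo 8.\<close>
    obtain u where u: "z\<^sup>2 + z = 2 * u"
      by (metis dvdE even_add even_power zero_less_numeral)
    have y: "y\<^sup>2 = 8 * u + 1"
      using u by (simp add: z power2_eq_square algebra_simps)
    have "r = 3 \<or> r = 5 \<or> r = 7"
      using r_cases parity False by auto
    then consider "r = 3" | "r = 5" | "r = 7" by blast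
    then show ?thesis
    proof cases
      case 1
      then have "y\<^sup>2 - d = 2 * (4 * u - 4 * q - 1)" using y d by simp
      then show ?thesis using 1 by (intro exI[of _ "4 * u - 4 * q - 1"]) (auto simp: r_def)
    next
      case 2
      then have "y\<^sup>2 - d = 4 * (2 * u - 2 * q - 1)" using y d by simp
      then show ?thesis using 2 by (intro exI[of _ "2 * u - 2 * q - 1"]) (auto simp: r_def)
    next
      case 3
      then have "y\<^sup>2 - d = 2 * (4 * u - 4 * q - 3)" using y d by simp
      then show ?thesis using 3 by (intro exI[of _ "4 * u - 4 * q - 3"]) (auto simp: r_def)
    qed
  qed
  then obtain w where w: "odd w" "y\<^sup>2 - d = 2 ^ (if d mod 8 = 5 then 2 else 1) * w" by blast
  have "nu2 (y\<^sup>2 - d) = enat (if d mod 8 = 5 then 2 else 1)"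
    unfolding w(2) nu2_mult nu2_power2 nu2_odd[OF w(1)] by simp
  then show ?thesis using True by (simp add: numeral_eq_enat one_enat_def)
next
  case False
  then show ?thesis by (auto intro: nu2_odd)
qed

text \<open>The descent step of the three inductions on \<open>k\<close> below.\<close>

lemma nu2_square_diff_pow4_Suc:
  fixes d :: int
  shows "nu2 ((2 * x)\<^sup>2 - 4 ^ Suc k * d) = 2 + nu2 (x\<^sup>2 - 4 ^ k * d)"
proof -
  have "(2 * x)\<^sup>2 - 4 ^ Suc k * d = 2 ^ 2 * (x\<^sup>2 - 4 ^ k * d)"
    by (simp add: power2_eq_square algebra_simps)
  then show ?thesis by (simp only: nu2_mult nu2_power2 numeral_eq_enat)
qed

text \<open>Each of at most \<open>k\<close> halvings of \<open>x\<close> contributes 2, and the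
  case \<open>k = 0\<close> at most 2 more. A descent that meets an odd argument earlier ends with
  valuation 0.\<close>

lemma nu2_square_diff_pow4_le:
  fixes d :: int
  assumes "d mod 8 \<in> {2, 3, 5, 6, 7}"
  shows "nu2 (x\<^sup>2 - 4 ^ k * d) \<le> enat (2 * k + 2)"
proof (induction k arbitrary: x)
  case 0
  show ?case using nu2_square_diff[OF assms, of x]
    by (auto simp: numeral_eq_enat one_enat_def zero_enat_def)
next
  case (Suc k)
  show ?case
  proof (cases "even x")
    case True
    then obtain y where "x = 2 * y" by blast
    then have "nu2 (x\<^sup>2 - 4 ^ Suc k * d) = 2 + nu2 (y\<^sup>2 - 4 ^ k * d)"
      by (simp only: nu2_square_diff_pow4_Suc)
    also have "\<dots> \<le> 2 + enat (2 * k + 2)" by (intro add_left_mono Suc.IH)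
    finally show ?thesis by (simp add: numeral_eq_enat)
  next
    case False
    then show ?thesis by (simp add: nu2_odd)
  qed
qed

text \<open>Each halving costs one factor 2 of the modulus; at \<open>k = 0\<close> the modulus 2
  remains, and there only the parity of the argument matters.\<close>

lemma nu2_square_diff_pow4_cong:
  fixes d :: int
  assumes "d mod 8 \<in> {2, 3, 5, 6, 7}" and "[x = x'] (mod 2 ^ Suc k)"
  shows "nu2 (x\<^sup>2 - 4 ^ k * d) = nu2 (x'\<^sup>2 - 4 ^ k * d)"
  using assms(2)
proof (induction k arbitrary: x x')
  case 0
  then have "even (x - d) \<longleftrightarrow> even (x' - d)"
    by (auto simp: cong_iff_dvd_diff)
  then show ?case using nu2_square_diff[OF assms(1)] by simp
next
  case (Suc k)
  then have dvd: "2 * 2 ^ Suc k dvd x - x'" by (simp add: cong_iff_dvd_diff)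
  then have "even (x - x')" by (rule dvd_mult_left)
  show ?case
  proof (cases "even x")
    case True
    then have "even x'" using \<open>even (x - x')\<close> by simp
    then obtain y y' where yy: "x = 2 * y" "x' = 2 * y'" using True by blast
    then have "2 * 2 ^ Suc k dvd 2 * (y - y')" using dvd by (simp only: yy right_diff_distrib)
    then have "[y = y'] (mod 2 ^ Suc k)"
      by (simp only: cong_iff_dvd_diff dvd_mult_cancel_left) simp
    then show ?thesis using Suc.IH by (simp only: yy nu2_square_diff_pow4_Suc)
  next
    case False
    then have "odd x'" using \<open>even (x - x')\<close> by simp
    then show ?thesis using False by (simp add: nu2_odd)
  qed
qed

text \<open>Exceeding \<open>2 * k\<close> requires all \<open>k\<close> halvings and then a
  quotient with the parity of \<open>d\<close>. The single residue class found here is what rules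
  out smaller periods.\<close>

lemma nu2_square_diff_pow4_gt_iff:
  fixes d :: int
  assumes "d mod 8 \<in> {2, 3, 5, 6, 7}"
  shows "enat (2 * k) < nu2 (x\<^sup>2 - 4 ^ k * d) \<longleftrightarrow> [x = 2 ^ k * d] (mod 2 ^ Suc k)"
proof (induction k arbitrary: x)
  case 0
  show ?case using nu2_square_diff[OF assms, of x]
    by (auto simp: zero_enat_def[symmetric] cong_iff_dvd_diff)
next
  case (Suc k)
  show ?case
  proof (cases "even x")
    case True
    then obtain y where y: "x = 2 * y" by blast
    then have "nu2 (x\<^sup>2 - 4 ^ Suc k * d) = 2 + nu2 (y\<^sup>2 - 4 ^ k * d)"
      by (simp only: nu2_square_diff_pow4_Suc)
    moreover have "enat (2 * Suc k) = 2 + enat (2 * k)" by (simp add: numeral_eq_enat)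
    ultimately have "enat (2 * Suc k) < nu2 (x\<^sup>2 - 4 ^ Suc k * d) \<longleftrightarrow>
        enat (2 * k) < nu2 (y\<^sup>2 - 4 ^ k * d)"
      by simp
    also have "\<dots> \<longleftrightarrow> [y = 2 ^ k * d] (mod 2 ^ Suc k)" by (rule Suc.IH)
    also have "\<dots> \<longleftrightarrow> 2 * 2 ^ Suc k dvd 2 * (y - 2 ^ k * d)"
      by (simp only: cong_iff_dvd_diff dvd_mult_cancel_left) simp
    also have "\<dots> \<longleftrightarrow> [x = 2 ^ Suc k * d] (mod 2 ^ Suc (Suc k))"
      by (simp add: cong_iff_dvd_diff y right_diff_distrib mult.assoc)
    finally show ?thesis .
  next
    case False
    have "\<not> [x = 2 ^ Suc k * d] (mod 2 ^ Suc (Suc k))"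
    proof
      assume "[x = 2 ^ Suc k * d] (mod 2 ^ Suc (Suc k))"
      then have "2 dvd x - 2 ^ Suc k * d"
        unfolding cong_iff_dvd_diff power_Suc by (rule dvd_mult_left)
      then show False using False by simp
    qed
    then show ?thesis using False by (simp add: nu2_odd)
  qed
qed

section \<open>Quadratics with odd leading and even middle coefficient\<close>

text \<open>Here \<open>h\<^sup>2 - a * c\<close> is a quarter of the discriminant. For odd
  \<open>a\<close> the extra factor on the left does not affect the valuation.\<close>

lemma quadratic_complete_square:
  fixes a b c h :: int
  assumes "b = 2 * h"
  shows "a * (a * n\<^sup>2 + b * n + c) = (a * n + h)\<^sup>2 - (h\<^sup>2 - a * c)"
  by (simp add: assms power2_eq_square algebra_simps)

text \<open>Covers discriminant 0 as well as the residue class 1 modulo 8: a square root modulo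
  \<open>2 ^ k\<close> is reached by \<open>a * int n + h\<close> because \<open>a\<close> is
  invertible.\<close>

lemma unbounded_if_disc_square:
  fixes a b c :: int
  assumes "odd a" and b: "b = 2 * h"
    and "\<And>k. \<exists>x. 2 ^ k dvd x\<^sup>2 - (h\<^sup>2 - a * c)"
  shows "\<not> bounded_seq (\<lambda>n. nu2 (a * (int n)\<^sup>2 + b * int n + c))"
proof (rule unbounded_nu2I)
  fix k
  obtain x where x: "2 ^ k dvd x\<^sup>2 - (h\<^sup>2 - a * c)" using assms(3) by blast
  obtain n :: nat where n: "[a * int n + h = x] (mod 2 ^ k)"
    using linear_cong_solvable[OF assms(1)] by blast
  have "[(a * int n + h)\<^sup>2 - (h\<^sup>2 - a * c) = x\<^sup>2 - (h\<^sup>2 - a * c)] (mod 2 ^ k)"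
    using n by (intro cong_diff cong_pow) auto
  then have "2 ^ k dvd a * (a * (int n)\<^sup>2 + b * int n + c)"
    using x by (simp only: quadratic_complete_square[OF b] cong_dvd_iff)
  moreover have "coprime (2 ^ k) a" using assms(1) by simp
  ultimately have "2 ^ k dvd a * (int n)\<^sup>2 + b * int n + c"
    using coprime_dvd_mult_right_iff by blast
  then show "\<exists>n. 2 ^ k dvd a * (int n)\<^sup>2 + b * int n + c" by blast
qed

text \<open>With the factor 4 of the discriminant removed, \<open>Suc k\<close> corresponds to the
  exponent l of the theorem.\<close>

lemma periodic_if_disc_nonsquare:
  fixes a b c :: int
  assumes "odd a" and b: "b = 2 * h"
    and D: "h\<^sup>2 - a * c = 4 ^ k * d"
    and d: "d mod 8 \<in> {2, 3, 5, 6, 7}"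
  defines "s \<equiv> \<lambda>n. nu2 (a * (int n)\<^sup>2 + b * int n + c)"
  shows "bounded_seq s" and "is_period s (2 ^ Suc k)" and "minimal_period s = 2 ^ Suc k"
proof -
  have s: "s n = nu2 ((a * int n + h)\<^sup>2 - 4 ^ k * d)" for n
  proof -
    have "s n = nu2 (a * (a * (int n)\<^sup>2 + b * int n + c))"
      using assms(1) by (simp add: s_def nu2_mult nu2_odd)
    then show ?thesis by (simp only: quadratic_complete_square[OF b] D)
  qed
  show "bounded_seq s"
    unfolding bounded_seq_def s using nu2_square_diff_pow4_le[OF d] by blast
  show per: "is_period s (2 ^ Suc k)"
    unfolding is_period_def s
  proof (intro conjI allI nu2_square_diff_pow4_cong[OF d])
    show "[a * int (n + 2 ^ Suc k) + h = a * int n + h] (mod 2 ^ Suc k)" for n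
      by (simp add: cong_iff_dvd_diff algebra_simps)
  qed simp
  have "2 ^ Suc k \<le> p" if p: "is_period s p" for p
  proof -
    \<comment> \<open>Start at an index in the class of high valuation. Any period leads back into
      that class, so \<open>2 ^ Suc k\<close> divides \<open>a * int p\<close>.\<close>
    obtain n :: nat where n: "[a * int n + h = 2 ^ k * d] (mod 2 ^ Suc k)"
      using linear_cong_solvable[OF assms(1)] by blast
    then have "enat (2 * k) < s n"
      by (simp only: s nu2_square_diff_pow4_gt_iff[OF d])
    then have "enat (2 * k) < s (n + p)"
      using p by (simp add: is_period_def)
    then have "[a * int (n + p) + h = 2 ^ k * d] (mod 2 ^ Suc k)"
      by (simp only: s nu2_square_diff_pow4_gt_iff[OF d])
    then have "[a * int (n + p) + h = a * int n + h] (mod 2 ^ Suc k)"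
      using n by (blast intro: cong_trans cong_sym)
    then have "2 ^ Suc k dvd a * int p"
      by (simp add: cong_iff_dvd_diff algebra_simps)
    moreover have "coprime (2 ^ Suc k) a" using assms(1) by simp
    ultimately have "2 ^ Suc k dvd int p"
      using coprime_dvd_mult_right_iff by blast
    then have "int (2 ^ Suc k) dvd int p" by simp
    then have "2 ^ Suc k dvd p" by (simp only: int_dvd_int_iff)
    then show ?thesis using p by (auto simp: is_period_def intro: dvd_imp_le)
  qed
  then show "minimal_period s = 2 ^ Suc k"
    unfolding minimal_period_def using per by (intro Least_equality)
qed

section \<open>The classification by parity and discriminant\<close>

theorem theorem1:
  fixes a b c :: int and f :: "nat \<Rightarrow> int"
  assumes f_def: "\<And>n. f n = a * (int n)\<^sup>2 + b * int n + c"
    and a_nonzero: "a \<noteq> 0"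
    and not_all_even: "\<not> (even a \<and> even b \<and> even c)"
  shows
    "(even a \<and> even b \<and> odd c \<longrightarrow> (\<forall>n. nu2 (f n) = 0)) \<and>
     (even a \<and> odd b \<longrightarrow> \<not> bounded_seq (\<lambda>n. nu2 (f n))) \<and>
     (odd a \<and> even b \<longrightarrow>
        (b\<^sup>2 - 4 * a * c = 0 \<longrightarrow> \<not> bounded_seq (\<lambda>n. nu2 (f n))) \<and>
        (\<forall>(l::nat) \<Delta>::int.
           largest_pow4_exponent (b\<^sup>2 - 4 * a * c) l \<and>
           b\<^sup>2 - 4 * a * c = 4 ^ l * \<Delta> \<and> [\<Delta> = 1] (mod 8) \<longrightarrow>
           \<not> bounded_seq (\<lambda>n. nu2 (f n))) \<and>
        (\<forall>(l::nat) (\<Delta>::int) m::int.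
           largest_pow4_exponent (b\<^sup>2 - 4 * a * c) l \<and>
           b\<^sup>2 - 4 * a * c = 4 ^ l * \<Delta> \<and> m \<in> {2, 3, 5, 6, 7} \<and> [\<Delta> = m] (mod 8) \<longrightarrow>
           bounded_seq (\<lambda>n. nu2 (f n)) \<and>
           periodic_seq (\<lambda>n. nu2 (f n)) \<and>
           minimal_period (\<lambda>n. nu2 (f n)) = 2 ^ l)) \<and>
     (odd a \<and> odd b \<and> even c \<longrightarrow> \<not> bounded_seq (\<lambda>n. nu2 (f n))) \<and>
     (odd a \<and> odd b \<and> odd c \<longrightarrow> (\<forall>n. nu2 (f n) = 0))"
proof -
  have f: "f = (\<lambda>n. a * (int n)\<^sup>2 + b * int n + c)" using f_def by blast
  have lift: "\<not> bounded_seq (\<lambda>n. nu2 (f n))" if "odd b" and "even (f m)" for m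
    using that unfolding f by (intro unbounded_nu2I quadratic_root_lift[of _ _ m])
  \<comment> \<open>Since b^2 = 4 h^2, cancelling 4 lowers the exponent by one.\<close>
  have disc: "h\<^sup>2 - a * c = 4 ^ k * d" if "b = 2 * h" and "b\<^sup>2 - 4 * a * c = 4 ^ Suc k * d"
    for h k d
    using that by (simp add: power_mult_distrib)
  show ?thesis
  proof (intro conjI impI allI; (elim conjE)?)
    show "nu2 (f n) = 0" if "even a" "even b" "odd c" for n
      using that by (intro nu2_odd) (simp add: f_def)
    show "nu2 (f n) = 0" if "odd a" "odd b" "odd c" for n
      using that by (intro nu2_odd) (simp add: f_def)
    show "\<not> bounded_seq (\<lambda>n. nu2 (f n))" if "even a" "odd b"
    \<comment> \<open>One of f(0) = c and f(1) = a + b + c is even, which gives the root modulo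
      2.\<close>
    proof (cases "even c")
      case True
      then show ?thesis using that by (intro lift[of 0]) (auto simp: f_def)
    next
      case False
      then show ?thesis using that by (intro lift[of 1]) (auto simp: f_def)
    qed
    show "\<not> bounded_seq (\<lambda>n. nu2 (f n))" if "odd a" "odd b" "even c"
      using that by (intro lift[of 0]) (auto simp: f_def)
  next
    assume "odd a" "even b" and D: "b\<^sup>2 - 4 * a * c = 0"
    then obtain h where h: "b = 2 * h" by blast
    have "h\<^sup>2 - a * c = 0" using D disc[OF h, of 0 0] by simp
    then show "\<not> bounded_seq (\<lambda>n. nu2 (f n))"
      unfolding f using \<open>odd a\<close> h by (intro unbounded_if_disc_square) (auto intro: exI[of _ 0])
  next
    fix l \<Delta>
    assume "odd a" "even b" and l: "largest_pow4_exponent (b\<^sup>2 - 4 * a * c) l"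
      and D: "b\<^sup>2 - 4 * a * c = 4 ^ l * \<Delta>" and \<Delta>: "[\<Delta> = 1] (mod 8)"
    then obtain h where h: "b = 2 * h" by blast
    \<comment> \<open>\<open>largest_pow4_exponent\<close> includes positivity of \<open>l\<close>,
      so a predecessor exists.\<close>
    obtain k where k: "l = Suc k" using l by (cases l) (auto simp: largest_pow4_exponent_def)
    have hD: "h\<^sup>2 - a * c = 4 ^ k * \<Delta>" using disc[OF h] D k by blast
    have "\<exists>x. 2 ^ j dvd x\<^sup>2 - (h\<^sup>2 - a * c)" for j
    proof -
      obtain y where y: "2 ^ j dvd y\<^sup>2 - \<Delta>" using sqrt_mod_power2[OF \<Delta>] by blast
      \<comment> \<open>Scaling a root of \<open>\<Delta>\<close> modulo \<open>2 ^ j\<close> by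
        \<open>2 ^ k\<close> gives a root of \<open>4 ^ k * \<Delta>\<close>.\<close>
      have "(2 ^ k * y)\<^sup>2 - (h\<^sup>2 - a * c) = 4 ^ k * (y\<^sup>2 - \<Delta>)"
        unfolding hD by (simp add: power_mult_distrib power2_eq_square algebra_simps
            flip: power_mult_distrib)
      then show ?thesis using y by (metis dvd_mult)
    qed
    then show "\<not> bounded_seq (\<lambda>n. nu2 (f n))"
      unfolding f using \<open>odd a\<close> h by (intro unbounded_if_disc_square)
  next
    fix l \<Delta> m
    assume "odd a" "even b" and l: "largest_pow4_exponent (b\<^sup>2 - 4 * a * c) l"
      and D: "b\<^sup>2 - 4 * a * c = 4 ^ l * \<Delta>" and m: "m \<in> {2, 3, 5, 6, 7}" "[\<Delta> = m] (mod 8)"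
    then obtain h where h: "b = 2 * h" by blast
    obtain k where k: "l = Suc k" using l by (cases l) (auto simp: largest_pow4_exponent_def)
    have hD: "h\<^sup>2 - a * c = 4 ^ k * \<Delta>" using disc[OF h] D k by blast
    have \<Delta>: "\<Delta> mod 8 \<in> {2, 3, 5, 6, 7}" using m by (auto simp: cong_def)
    note per = periodic_if_disc_nonsquare[OF \<open>odd a\<close> h hD \<Delta>]
    show "bounded_seq (\<lambda>n. nu2 (f n))" unfolding f by (rule per(1))
    show "periodic_seq (\<lambda>n. nu2 (f n))" unfolding f periodic_seq_def using per(2) by blast
    show "minimal_period (\<lambda>n. nu2 (f n)) = 2 ^ l" unfolding f k by (rule per(3))
  qed
qed

end
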